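(* Consider the carpooling market described in the context. A market equilibrium $(x^*,p^*,\tau^* )$ exists if and only if the linear program (LP) has an optimal solution that is integer-valued. Moreover, when (LP) has an integer optimal solution: any integer optimal solution $x^*$ of (LP) is an equilibrium trip vector, any optimal solution $(u^*,\tau^* )$ of (D) consists of an equilibrium utility vector $u^*$ and an equilibrium toll vector $\tau^*$, and the corresponding equilibrium payment vector $p^*$ (making $(x^*,p^*,\tau^* )$ a market equilibrium) is given by $$p^{m*}=\sum_{r\in R}\ \sum_{b\in B,\, b\ni m} x^*_r(b)\, v_r^m(b) - u^{m*},\qquad \forall m\in M.$$
   Context: Network and riders. A finite directed network with a single origin–destination pair has edge set $E$, positive integer edge capacities $q_e$ and edge travel times $t_e>0$ ($e\in E$). $R$ is the set of routes (directed paths from origin to destination), and $t_r=\sum_{e\in r}t_e$. $M$ is a finite set of riders, $A$ a positive integer (car capacity), and $B$ the set of nonempty groups $b\subseteq M$ with $|b|\le A$. A trip is a pair $(b,r)\in B\times R$. Rider $m$ has real parameters $\alpha^m,\beta^m$ and carpool disutilities $\gamma^m(d)\ge 0$, $d=1,\dots,A$, with $\gamma^m(1)=0$ and $\gamma^m(d)-\gamma^m(d-1)$ non-decreasing in $d=2,\dots,A$; $\delta\ge 0$ is a constant. For $m\in b$: $v_r^m(b)=\alpha^m-\beta^m t_r-\gamma^m(|b|)t_r$. The trip cost is $c_r(b)=\delta|b|t_r$, and the trip value is $V_r(b)=\sum_{m\in b}v_r^m(b)-c_r(b)$. Market outcomes. An outcome is $(x,p,\tau)$ with trip vector $x=(x_r(b))_{r\in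 R,b\in B}\in\{0,1\}^{B\times R}$ satisfying $\sum_{r}\sum_{b\ni m}x_r(b)\le 1$ for all $m\in M$ and $\sum_{r\ni e}\sum_{b\in B}x_r(b)\le q_e$ for all $e\in E$; payments $p=(p^m)_{m\in M}\in\mathbb{R}^M$; and tolls $\tau=(\tau_e)_{e\in E}\in\mathbb{R}_{\ge0}^E$. The induced utilities are $u^m=\sum_r\sum_{b\ni m}v_r^m(b)x_r(b)-p^m$. An outcome is a market equilibrium if it is: individually rational ($u^m\ge 0$ for all $m$); stable ($\sum_{m\in b}u^m\ge V_r(b)-\sum_{e\in r}\tau_e$ for all $b\in B$, $r\in R$); budget balanced (if $x_r(b)=1$ then $\sum_{m\in b}p^m=\sum_{e\in r}\tau_e+c_r(b)$; and if $x_r(b)=0$ for all $r\in R$ and all $b\ni m$ then $p^m=0$); and market clearing (if $\sum_{r\ni e}\sum_b x_r(b)<q_e$ then $\tau_e=0$). The equilibrium trip, utility and toll vectors are the components $x^*$, the induced $u^*$, and $\tau^*$ of a market equilibrium. (LP): maximize $\sum_{b\in B}\sum_{r\in R}V_r(b)x_r(b)$ subject to $\sum_{r}\sum_{b\ni m}x_r(b)\le1$ for all $m\in M$, $\sum_{r\ni e}\sum_{b}x_r(b)\le q_e$ for all $e\in E$, and $x_r(b)\ge0$ for all $b\in B$, $r\in R$. (D): minimize $\sum_{m\in M}u^m+\sum_{e\in E}q_e\tau_e$ subject to $\sum_{m\in b}u^m+\sum_{e\in r}\tau_e\ge V_r(b)$ for all $b\in B$, $r\in R$, and $u^m\ge0$,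 $\tau_e\ge0$ for all $m\in M$, $e\in E$. *)

theory Defs
  imports Complex_Main "Graph_Theory.Arc_Walk"
begin

record ('v, 'e, 'm) market =
  network :: "('v, 'e) pre_digraph"
  origin :: 'v
  destination :: 'v
  capacity :: "'e \<Rightarrow> nat"
  travel_time :: "'e \<Rightarrow> real"
  riders :: "'m set"
  car_capacity :: nat
  alpha :: "'m \<Rightarrow> real"
  beta :: "'m \<Rightarrow> real"
  gamma :: "'m \<Rightarrow> nat \<Rightarrow> real"
  delta :: real

locale carpooling_market = fin_digraph "network K"
  for K :: "('v, 'e, 'm) market" +
  assumes origin_in_verts: "origin K \<in> verts (network K)"
    and destination_in_verts: "destination K \<in> verts (network K)"
    and capacity_pos: "\<And>e. e \<in> arcs (network K) \<Longrightarrow> capacity K e > 0"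
    and travel_time_pos: "\<And>e. e \<in> arcs (network K) \<Longrightarrow> travel_time K e > 0"
    and finite_riders: "finite (riders K)"
    and car_capacity_pos: "car_capacity K > 0"
    and gamma_nonneg:
      "\<And>m d. m \<in> riders K \<Longrightarrow> d \<in> {1..car_capacity K} \<Longrightarrow> gamma K m d \<ge> 0"
    and gamma_one: "\<And>m. m \<in> riders K \<Longrightarrow> gamma K m 1 = 0"
    and gamma_increments_mono:
      "\<And>m. m \<in> riders K \<Longrightarrow>
        mono_on {2..car_capacity K} (\<lambda>d. gamma K m d - gamma K m (d - 1))"
    and delta_nonneg: "delta K \<ge> 0"

text \<open>
  Vectors indexed by riders, edges or trips are total functions; only their values on
  \<open>riders K\<close>, \<open>edges K\<close> and \<open>routes K\<close> \<open>\<times>\<close> \<open>groups K\<close>, respectively, matter.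
\<close>

type_synonym ('e, 'm) trip_vector = "'e list \<Rightarrow> 'm set \<Rightarrow> real"

abbreviation edges :: "('v, 'e, 'm) market \<Rightarrow> 'e set" where
  "edges K \<equiv> arcs (network K)"

text \<open>
  A route is the arc list of a path without repeated vertices. It has no repeated arc either,
  so sums over its arcs can be taken over its set of arcs.
\<close>

definition routes :: "('v, 'e, 'm) market \<Rightarrow> 'e list set" where
  "routes K = {r. pre_digraph.apath (network K) (origin K) r (destination K)}"

definition groups :: "('v, 'e, 'm) market \<Rightarrow> 'm set set" where
  "groups K = {b. b \<subseteq> riders K \<and> b \<noteq> {} \<and> card b \<le> car_capacity K}"

definition route_time :: "('v, 'e, 'm) market \<Rightarrow> 'e list \<Rightarrow> real" where
  "route_time K r = (\<Sum>e\<in>set r. travel_time K e)"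

definition rider_value :: "('v, 'e, 'm) market \<Rightarrow> 'm \<Rightarrow> 'e list \<Rightarrow> 'm set \<Rightarrow> real" where
  "rider_value K m r b =
     alpha K m - beta K m * route_time K r - gamma K m (card b) * route_time K r"

definition trip_cost :: "('v, 'e, 'm) market \<Rightarrow> 'e list \<Rightarrow> 'm set \<Rightarrow> real" where
  "trip_cost K r b = delta K * real (card b) * route_time K r"

definition trip_value :: "('v, 'e, 'm) market \<Rightarrow> 'e list \<Rightarrow> 'm set \<Rightarrow> real" where
  "trip_value K r b = (\<Sum>m\<in>b. rider_value K m r b) - trip_cost K r b"

definition rider_load :: "('v, 'e, 'm) market \<Rightarrow> ('e, 'm) trip_vector \<Rightarrow> 'm \<Rightarrow> real" where
  "rider_load K x m = (\<Sum>r\<in>routes K. \<Sum>b\<in>{b \<in> groups K. m \<in> b}. x r b)"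

definition edge_load :: "('v, 'e, 'm) market \<Rightarrow> ('e, 'm) trip_vector \<Rightarrow> 'e \<Rightarrow> real" where
  "edge_load K x e = (\<Sum>r\<in>{r \<in> routes K. e \<in> set r}. \<Sum>b\<in>groups K. x r b)"

definition gross_value :: "('v, 'e, 'm) market \<Rightarrow> ('e, 'm) trip_vector \<Rightarrow> 'm \<Rightarrow> real" where
  "gross_value K x m =
     (\<Sum>r\<in>routes K. \<Sum>b\<in>{b \<in> groups K. m \<in> b}. x r b * rider_value K m r b)"


definition outcome ::
    "('v, 'e, 'm) market \<Rightarrow> ('e, 'm) trip_vector \<Rightarrow> ('m \<Rightarrow> real) \<Rightarrow> ('e \<Rightarrow> real) \<Rightarrow> bool" where
  "outcome K x p \<tau> \<longleftrightarrow>
     (\<forall>r\<in>routes K. \<forall>b\<in>groups K. x r b \<in> {0, 1}) \<and>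
     (\<forall>m\<in>riders K. rider_load K x m \<le> 1) \<and>
     (\<forall>e\<in>edges K. edge_load K x e \<le> real (capacity K e)) \<and>
     (\<forall>e\<in>edges K. \<tau> e \<ge> 0)"

definition utility ::
    "('v, 'e, 'm) market \<Rightarrow> ('e, 'm) trip_vector \<Rightarrow> ('m \<Rightarrow> real) \<Rightarrow> 'm \<Rightarrow> real" where
  "utility K x p m = gross_value K x m - p m"

definition individually_rational ::
    "('v, 'e, 'm) market \<Rightarrow> ('e, 'm) trip_vector \<Rightarrow> ('m \<Rightarrow> real) \<Rightarrow> bool" where
  "individually_rational K x p \<longleftrightarrow> (\<forall>m\<in>riders K. utility K x p m \<ge> 0)"

definition stable ::
    "('v, 'e, 'm) market \<Rightarrow> ('e, 'm) trip_vector \<Rightarrow> ('m \<Rightarrow> real) \<Rightarrow> ('e \<Rightarrow> real) \<Rightarrow> bool" where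
  "stable K x p \<tau> \<longleftrightarrow>
     (\<forall>b\<in>groups K. \<forall>r\<in>routes K.
        (\<Sum>m\<in>b. utility K x p m) \<ge> trip_value K r b - (\<Sum>e\<in>set r. \<tau> e))"

definition budget_balanced ::
    "('v, 'e, 'm) market \<Rightarrow> ('e, 'm) trip_vector \<Rightarrow> ('m \<Rightarrow> real) \<Rightarrow> ('e \<Rightarrow> real) \<Rightarrow> bool" where
  "budget_balanced K x p \<tau> \<longleftrightarrow>
     (\<forall>b\<in>groups K. \<forall>r\<in>routes K.
        x r b = 1 \<longrightarrow> (\<Sum>m\<in>b. p m) = (\<Sum>e\<in>set r. \<tau> e) + trip_cost K r b) \<and>
     (\<forall>m\<in>riders K.
        (\<forall>r\<in>routes K. \<forall>b\<in>groups K. m \<in> b \<longrightarrow> x r b = 0) \<longrightarrow> p m = 0)"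

definition market_clearing ::
    "('v, 'e, 'm) market \<Rightarrow> ('e, 'm) trip_vector \<Rightarrow> ('e \<Rightarrow> real) \<Rightarrow> bool" where
  "market_clearing K x \<tau> \<longleftrightarrow>
     (\<forall>e\<in>edges K. edge_load K x e < real (capacity K e) \<longrightarrow> \<tau> e = 0)"

definition market_equilibrium ::
    "('v, 'e, 'm) market \<Rightarrow> ('e, 'm) trip_vector \<Rightarrow> ('m \<Rightarrow> real) \<Rightarrow> ('e \<Rightarrow> real) \<Rightarrow> bool" where
  "market_equilibrium K x p \<tau> \<longleftrightarrow>
     outcome K x p \<tau> \<and> individually_rational K x p \<and> stable K x p \<tau> \<and>
     budget_balanced K x p \<tau> \<and> market_clearing K x \<tau>"


definition lp_feasible :: "('v, 'e, 'm) market \<Rightarrow> ('e, 'm) trip_vector \<Rightarrow> bool" where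
  "lp_feasible K x \<longleftrightarrow>
     (\<forall>m\<in>riders K. rider_load K x m \<le> 1) \<and>
     (\<forall>e\<in>edges K. edge_load K x e \<le> real (capacity K e)) \<and>
     (\<forall>b\<in>groups K. \<forall>r\<in>routes K. x r b \<ge> 0)"

definition lp_objective :: "('v, 'e, 'm) market \<Rightarrow> ('e, 'm) trip_vector \<Rightarrow> real" where
  "lp_objective K x = (\<Sum>b\<in>groups K. \<Sum>r\<in>routes K. trip_value K r b * x r b)"

definition lp_optimal :: "('v, 'e, 'm) market \<Rightarrow> ('e, 'm) trip_vector \<Rightarrow> bool" where
  "lp_optimal K x \<longleftrightarrow> is_arg_max (lp_objective K) (lp_feasible K) x"

definition integer_valued :: "('v, 'e, 'm) market \<Rightarrow> ('e, 'm) trip_vector \<Rightarrow> bool" where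
  "integer_valued K x \<longleftrightarrow> (\<forall>b\<in>groups K. \<forall>r\<in>routes K. x r b \<in> \<int>)"

definition dual_feasible ::
    "('v, 'e, 'm) market \<Rightarrow> ('m \<Rightarrow> real) \<times> ('e \<Rightarrow> real) \<Rightarrow> bool" where
  "dual_feasible K = (\<lambda>(u, \<tau>).
     (\<forall>b\<in>groups K. \<forall>r\<in>routes K.
        (\<Sum>m\<in>b. u m) + (\<Sum>e\<in>set r. \<tau> e) \<ge> trip_value K r b) \<and>
     (\<forall>m\<in>riders K. u m \<ge> 0) \<and> (\<forall>e\<in>edges K. \<tau> e \<ge> 0))"

definition dual_objective ::
    "('v, 'e, 'm) market \<Rightarrow> ('m \<Rightarrow> real) \<times> ('e \<Rightarrow> real) \<Rightarrow> real" where
  "dual_objective K = (\<lambda>(u, \<tau>).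
     (\<Sum>m\<in>riders K. u m) + (\<Sum>e\<in>edges K. real (capacity K e) * \<tau> e))"

definition dual_optimal ::
    "('v, 'e, 'm) market \<Rightarrow> ('m \<Rightarrow> real) \<Rightarrow> ('e \<Rightarrow> real) \<Rightarrow> bool" where
  "dual_optimal K u \<tau> \<longleftrightarrow> is_arg_min (dual_objective K) (dual_feasible K) (u, \<tau>)"

end

theory Submission
  imports Defs
begin

text \<open>
  The utilities and tolls of an equilibrium form a feasible solution of the dual program:
  individual rationality and stability are its constraints. For a binary trip vector, budget
  balance and market clearing are exactly complementary slackness, i.e. a zero duality gap.
  Hence equilibria are the pairs of an integer primal and a dual solution with equal objective
  values, and the theorem reduces to strong duality for linear programs, which follows from
  Farkas' lemma by Fourier--Motzkin elimination.
\<close>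

section \<open>Conic combinations of linear inequalities\<close>

text \<open>A pair \<open>(a, d)\<close> stands for the constraint \<open>d \<le> (\<Sum>j. a j * y j)\<close> on \<open>y\<close>.\<close>

inductive_set conic_combinations :: "(('j \<Rightarrow> real) \<times> real) set \<Rightarrow> (('j \<Rightarrow> real) \<times> real) set"
  for G where
  zero: "(\<lambda>_. 0, 0) \<in> conic_combinations G"
| add: "(a, d) \<in> G \<Longrightarrow> (a', d') \<in> conic_combinations G \<Longrightarrow> c \<ge> 0 \<Longrightarrow>
    (\<lambda>j. c * a j + a' j, c * d + d') \<in> conic_combinations G"

lemma conic_combinations_base:
  assumes "(a, d) \<in> G"
  shows "(a, d) \<in> conic_combinations G"
  using conic_combinations.add[OF assms conic_combinations.zero, of 1] by simp

lemma conic_combinations_plus: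
  assumes "(a, d) \<in> conic_combinations G" "(a', d') \<in> conic_combinations G"
  shows "(\<lambda>j. a j + a' j, d + d') \<in> conic_combinations G"
  using assms
proof (induction rule: conic_combinations.induct)
  case zero
  then show ?case by simp
next
  case (add a1 d1 a2 d2 c)
  then show ?case
    using conic_combinations.add[OF add.hyps(1) add.IH[OF add.prems] add.hyps(3)]
    by (simp add: add.assoc)
qed

lemma conic_combinations_scale:
  assumes "(a, d) \<in> conic_combinations G" "s \<ge> 0"
  shows "(\<lambda>j. s * a j, s * d) \<in> conic_combinations G"
  using assms
proof (induction rule: conic_combinations.induct)
  case zero
  then show ?case using conic_combinations.zero by simp
next
  case (add a1 d1 a2 d2 c)
  have "s * c \<ge> 0" using add by simp
  from conic_combinations.add[OF add.hyps(1) add.IH[OF add.prems] this]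
  show ?case by (simp add: algebra_simps)
qed

text \<open>A contradiction found in an eliminated system is pulled back this way: its inequalities
  are themselves conic combinations of the original ones.\<close>

lemma conic_combinations_subset:
  assumes "G' \<subseteq> conic_combinations G"
  shows "conic_combinations G' \<subseteq> conic_combinations G"
proof -
  have "(a, d) \<in> conic_combinations G" if "(a, d) \<in> conic_combinations G'" for a d
    using that
  proof (induction rule: conic_combinations.induct)
    case zero
    then show ?case by (rule conic_combinations.zero)
  next
    case (add a1 d1 a2 d2 c)
    have "(a1, d1) \<in> conic_combinations G" using add.hyps(1) assms by blast
    from conic_combinations_plus[OF conic_combinations_scale[OF this add.hyps(3)] add.IH]
    show ?case .
  qed
  then show ?thesis by auto
qed

text \<open>The induction hypothesis in \<open>farkas\<close> tests coefficients only on
  \<open>J\<close>; for the eliminated variable this supplies the missing zero.\<close>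

lemma conic_combinations_coeff_zero:
  assumes "(a, d) \<in> conic_combinations G" "\<And>a d. (a, d) \<in> G \<Longrightarrow> a k = 0"
  shows "a k = 0"
  using assms by (induction rule: conic_combinations.induct) auto

section \<open>Farkas' lemma\<close>

text \<open>Provides the value of an eliminated variable, squeezed between its lower and upper
  bounds. Bounds of either kind may be missing, and \<open>Min\<close> and \<open>Max\<close> say
  nothing useful about empty sets, hence the cases.\<close>

lemma real_between_finite_sets:
  fixes L U :: "real set"
  assumes "finite L" "finite U" "\<And>l u. l \<in> L \<Longrightarrow> u \<in> U \<Longrightarrow> l \<le> u"
  shows "\<exists>t. (\<forall>l\<in>L. l \<le> t) \<and> (\<forall>u\<in>U. t \<le> u)"
proof (cases "L = {}")
  case True
  show ?thesis
  proof (cases "U = {}")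
    case True
    with \<open>L = {}\<close> show ?thesis by simp
  next
    case False
    with \<open>L = {}\<close> assms show ?thesis by (intro exI[of _ "Min U"]) simp
  qed
next
  case False
  with assms show ?thesis by (intro exI[of _ "Max L"]) simp
qed

text \<open>Fourier--Motzkin elimination of one variable at a time.\<close>

lemma farkas:
  fixes G :: "(('j \<Rightarrow> real) \<times> real) set"
  assumes "finite J" "finite G"
    and "\<And>a d. (a, d) \<in> conic_combinations G \<Longrightarrow> (\<And>j. j \<in> J \<Longrightarrow> a j = 0) \<Longrightarrow> d \<le> 0"
  shows "\<exists>y. \<forall>(a, d)\<in>G. d \<le> (\<Sum>j\<in>J. a j * y j)"
  using assms
proof (induction J arbitrary: G rule: finite_induct)
  case empty
  then show ?case by (auto dest: conic_combinations_base)
next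
  case (insert k J G)
  \<comment> \<open>Solved for the variable \<open>k\<close>, the constraints in \<open>P\<close>
    bound it from below and those in \<open>N\<close> from above.\<close>
  define P where "P = {g \<in> G. fst g k > 0}"
  define N where "N = {g \<in> G. fst g k < 0}"
  \<comment> \<open>For \<open>g\<close> in \<open>P\<close> and \<open>h\<close> in
    \<open>N\<close> the multipliers \<open>- fst h k\<close> and \<open>fst g k\<close> are
    positive, and the coefficient of \<open>k\<close> cancels.\<close>
  define mix where "mix = (\<lambda>(g, h). (\<lambda>j. - fst h k * fst g j + fst g k * fst h j,
      - fst h k * snd g + fst g k * snd h) :: ('j \<Rightarrow> real) \<times> real)"
  define G' where "G' = {g \<in> G. fst g k = 0} \<union> mix ` (P \<times> N)"
  have fin: "finite P" "finite N" "finite G'"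
    using insert.prems(1) unfolding P_def N_def G'_def by auto
  have "mix (g, h) \<in> conic_combinations G" if "g \<in> P" "h \<in> N" for g h
  proof -
    have "(fst g, snd g) \<in> conic_combinations G" "(fst h, snd h) \<in> conic_combinations G"
      using that conic_combinations_base[of "fst g" "snd g" G]
        conic_combinations_base[of "fst h" "snd h" G] by (auto simp: P_def N_def)
    moreover have "- fst h k \<ge> 0" "fst g k \<ge> 0"
      using that by (auto simp: P_def N_def)
    ultimately show ?thesis
      unfolding mix_def split using conic_combinations_plus conic_combinations_scale by blast
  qed
  then have "G' \<subseteq> conic_combinations G"
    unfolding G'_def by (auto intro: conic_combinations_base)
  then have sub: "conic_combinations G' \<subseteq> conic_combinations G"
    by (rule conic_combinations_subset)
  have zero: "a k = 0" if "(a, d) \<in> G'" for a d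
    using that by (auto simp: G'_def mix_def)
  have "\<exists>y. \<forall>(a, d)\<in>G'. d \<le> (\<Sum>j\<in>J. a j * y j)"
  proof (rule insert.IH[OF fin(3)])
    fix a d
    assume a: "(a, d) \<in> conic_combinations G'" "\<And>j. j \<in> J \<Longrightarrow> a j = 0"
    have "a k = 0" using conic_combinations_coeff_zero[OF a(1)] zero by blast
    then show "d \<le> 0" using a sub insert.prems(2)[of a d] by auto
  qed
  then obtain y where y: "\<forall>(a, d)\<in>G'. d \<le> (\<Sum>j\<in>J. a j * y j)" by blast
  \<comment> \<open>With the remaining variables fixed to \<open>y\<close>, this is the bound that
    \<open>g\<close> puts on variable \<open>k\<close>: a lower one on \<open>P\<close>, an upper
    one on \<open>N\<close>.\<close>
  define bnd where "bnd = (\<lambda>g. (snd g - (\<Sum>j\<in>J. fst g j * y j)) / fst g k)"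
  have bnd_le: "bnd g \<le> bnd h" if "g \<in> P" "h \<in> N" for g h
  proof -
    have "mix (g, h) \<in> G'" using that by (auto simp: G'_def)
    with y have "snd (mix (g, h)) \<le> (\<Sum>j\<in>J. fst (mix (g, h)) j * y j)" by fastforce
    also have "\<dots> = - fst h k * (\<Sum>j\<in>J. fst g j * y j) + fst g k * (\<Sum>j\<in>J. fst h j * y j)"
      by (simp add: mix_def algebra_simps sum.distrib sum_distrib_left sum_subtractf sum_negf)
    \<comment> \<open>Division by the positive number \<open>- fst h k * fst g k\<close> turns this
      into \<open>bnd g \<le> bnd h\<close>.\<close>
    finally have "- fst h k * (snd g - (\<Sum>j\<in>J. fst g j * y j))
        \<le> - fst g k * (snd h - (\<Sum>j\<in>J. fst h j * y j))"
      by (simp add: mix_def algebra_simps)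
    then show ?thesis
      using that by (simp add: bnd_def P_def N_def field_simps)
  qed
  have "\<exists>t. (\<forall>l\<in>bnd ` P. l \<le> t) \<and> (\<forall>u\<in>bnd ` N. t \<le> u)"
    using fin bnd_le by (intro real_between_finite_sets) auto
  then obtain t where t: "\<And>g. g \<in> P \<Longrightarrow> bnd g \<le> t" "\<And>h. h \<in> N \<Longrightarrow> t \<le> bnd h"
    by auto
  have "snd g \<le> (\<Sum>j\<in>insert k J. fst g j * (y(k := t)) j)" if g: "g \<in> G" for g
  proof -
    have J: "(\<Sum>j\<in>insert k J. fst g j * (y(k := t)) j) = fst g k * t + (\<Sum>j\<in>J. fst g j * y j)"
      using insert.hyps by (simp, intro sum.cong) auto
    consider "fst g k = 0" | "g \<in> P" | "g \<in> N"
      using g linorder_less_linear[of "fst g k" 0] by (auto simp: P_def N_def)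
    then show ?thesis
    proof cases
      case 1
      then have "g \<in> G'" using g by (simp add: G'_def)
      with y 1 J show ?thesis by (auto simp: case_prod_beta)
    next
      case 2
      with t(1)[OF 2] J show ?thesis by (simp add: bnd_def P_def field_simps)
    next
      case 3
      with t(2)[OF 3] J show ?thesis by (simp add: bnd_def N_def field_simps)
    qed
  qed
  then show ?case by (intro exI[of _ "y(k := t)"]) auto
qed

section \<open>Strong duality of linear programs\<close>

text \<open>Dual feasibility, together with the demand that the dual value not exceed the primal
  optimum, is a linear system in \<open>y\<close>. By \<open>farkas\<close> it is solvable unless
  some conic combination of it is contradictory, and such a combination would yield a primal
  solution better than \<open>x\<close>.\<close>

lemma lp_strong_duality:
  fixes A :: "'i \<Rightarrow> 'j \<Rightarrow> real"
  assumes fin: "finite I" "finite J"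
    and x_nonneg: "\<And>j. j \<in> J \<Longrightarrow> x j \<ge> 0"
    and x_feasible: "\<And>i. i \<in> I \<Longrightarrow> (\<Sum>j\<in>J. A i j * x j) \<le> b i"
    and x_optimal: "\<And>z. (\<And>j. j \<in> J \<Longrightarrow> z j \<ge> 0) \<Longrightarrow>
      (\<And>i. i \<in> I \<Longrightarrow> (\<Sum>j\<in>J. A i j * z j) \<le> b i) \<Longrightarrow>
      (\<Sum>j\<in>J. c j * z j) \<le> (\<Sum>j\<in>J. c j * x j)"
  shows "\<exists>y. (\<forall>i\<in>I. y i \<ge> 0) \<and> (\<forall>j\<in>J. c j \<le> (\<Sum>i\<in>I. A i j * y i)) \<and>
    (\<Sum>i\<in>I. b i * y i) \<le> (\<Sum>j\<in>J. c j * x j)"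
proof -
  define v where "v = (\<Sum>j\<in>J. c j * x j)"
  \<comment> \<open>The three families encode \<open>y i \<ge> 0\<close>, the dual constraint of
    each column \<open>j\<close>, and the bound \<open>v\<close> on the dual objective, negated to
    fit the direction of the inequalities.\<close>
  define G where "G = (\<lambda>i. (\<lambda>i'. of_bool (i' = i), 0)) ` I \<union> (\<lambda>j. (\<lambda>i. A i j, c j)) ` J
      \<union> {(\<lambda>i. - b i, - v)}"
  \<comment> \<open>Here \<open>z\<close> collects the multipliers of the columns and
    \<open>t\<close> that of the objective bound. Multipliers of the sign constraints can only raise
    \<open>a\<close>, so an inequality with \<open>a\<close> replaces an equation.\<close>
  have comb: "\<exists>z t. (\<forall>j\<in>J. z j \<ge> 0) \<and> t \<ge> 0 \<and> (\<forall>i\<in>I. (\<Sum>j\<in>J. A i j * z j) - t * b i \<le> a i) \<and>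
      d = (\<Sum>j\<in>J. c j * z j) - t * v" if "(a, d) \<in> conic_combinations G" for a d
    using that
  proof (induction rule: conic_combinations.induct)
    case zero
    show ?case by (intro exI[of _ "\<lambda>_. 0"] exI[of _ 0]) simp
  next
    case (add a1 d1 a2 d2 s)
    then obtain z t where zt: "\<forall>j\<in>J. z j \<ge> 0" "t \<ge> 0"
      "\<forall>i\<in>I. (\<Sum>j\<in>J. A i j * z j) - t * b i \<le> a2 i" "d2 = (\<Sum>j\<in>J. c j * z j) - t * v" by blast
    from add.hyps(1) consider (unit) i where "i \<in> I" "a1 = (\<lambda>i'. of_bool (i' = i))" "d1 = 0"
      | (column) k where "k \<in> J" "a1 = (\<lambda>i. A i k)" "d1 = c k"
      | (bound) "a1 = (\<lambda>i. - b i)" "d1 = - v"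
      by (auto simp: G_def)
    then show ?case
    proof cases
      case unit
      then have "a2 i \<le> s * a1 i + a2 i" for i using \<open>s \<ge> 0\<close> by simp
      then have "\<forall>i\<in>I. (\<Sum>j\<in>J. A i j * z j) - t * b i \<le> s * a1 i + a2 i"
        using zt(3) by (meson order_trans)
      moreover have "s * d1 + d2 = (\<Sum>j\<in>J. c j * z j) - t * v"
        using zt(4) unit by simp
      ultimately show ?thesis using zt(1,2) by blast
    next
      case column
      \<comment> \<open>Column \<open>k\<close> may already carry a multiplier, so \<open>s\<close>
        is added to it.\<close>
      let ?z = "z(k := z k + s)"
      have upd: "(\<Sum>j\<in>J. f j * ?z j) = s * f k + (\<Sum>j\<in>J. f j * z j)" for f
      proof -
        have "(\<Sum>j\<in>J - {k}. f j * ?z j) = (\<Sum>j\<in>J - {k}. f j * z j)"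
          by (intro sum.cong) auto
        then show ?thesis
          using column(1) fin(2) by (simp add: sum.remove[of J k] algebra_simps)
      qed
      have "\<forall>j\<in>J. ?z j \<ge> 0" using zt(1) column(1) \<open>s \<ge> 0\<close> by simp
      moreover have "\<forall>i\<in>I. (\<Sum>j\<in>J. A i j * ?z j) - t * b i \<le> s * a1 i + a2 i"
        using zt(3) column(2) unfolding upd by fastforce
      moreover have "s * d1 + d2 = (\<Sum>j\<in>J. c j * ?z j) - t * v"
        using zt(4) column(3) unfolding upd by simp
      ultimately show ?thesis using zt(2) by blast
    next
      case bound
      show ?thesis
        using zt bound \<open>s \<ge> 0\<close>
        by (intro exI[of _ z] exI[of _ "t + s"]) (auto simp: algebra_simps)
    qed
  qed
  have "d \<le> 0" if "(a, d) \<in> conic_combinations G" and a: "\<And>i. i \<in> I \<Longrightarrow> a i = 0" for a d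
  proof -
    from comb[OF that(1)] a obtain z t where z: "\<And>j. j \<in> J \<Longrightarrow> z j \<ge> 0" and "t \<ge> 0"
      and Az: "\<And>i. i \<in> I \<Longrightarrow> (\<Sum>j\<in>J. A i j * z j) \<le> t * b i"
      and d: "d = (\<Sum>j\<in>J. c j * z j) - t * v" by fastforce
    show ?thesis
    proof (cases "t = 0")
      case True
      \<comment> \<open>Here \<open>z\<close> is a recession direction of the feasible region.\<close>
      have "(\<Sum>j\<in>J. c j * (x j + z j)) \<le> v"
        unfolding v_def
      proof (rule x_optimal)
        show "(\<Sum>j\<in>J. A i j * (x j + z j)) \<le> b i" if "i \<in> I" for i
          using x_feasible[OF that] Az[OF that] True by (simp add: algebra_simps sum.distrib)
      qed (simp add: x_nonneg z)
      then show ?thesis using d True by (simp add: v_def algebra_simps sum.distrib)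
    next
      case False
      with \<open>t \<ge> 0\<close> have "t > 0" by simp
      \<comment> \<open>Scaling by \<open>1 / t\<close> makes \<open>z\<close> primal feasible, so
        optimality of \<open>x\<close> applies to it.\<close>
      have "(\<Sum>j\<in>J. c j * (z j / t)) \<le> v"
        unfolding v_def
      proof (rule x_optimal)
        show "(\<Sum>j\<in>J. A i j * (z j / t)) \<le> b i" if "i \<in> I" for i
          using Az[OF that] \<open>t > 0\<close> by (simp add: sum_divide_distrib[symmetric] field_simps)
      qed (simp add: z \<open>t \<ge> 0\<close>)
      then show ?thesis
        using d \<open>t > 0\<close> by (simp add: sum_divide_distrib[symmetric] field_simps)
    qed
  qed
  moreover have "finite G" using fin by (simp add: G_def)
  ultimately obtain y where y: "\<forall>(a, d)\<in>G. d \<le> (\<Sum>i\<in>I. a i * y i)"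
    using farkas[OF fin(1), of G] by blast
  show ?thesis
  proof (intro exI[of _ y] conjI ballI)
    show "y i \<ge> 0" if "i \<in> I" for i
    proof -
      have "(\<lambda>i'. of_bool (i' = i), 0) \<in> G" using that by (auto simp: G_def)
      with y have "0 \<le> (\<Sum>i'\<in>I. of_bool (i' = i) * y i')" by fastforce
      also have "\<dots> = y i"
        using that fin(1) by (simp add: of_bool_def if_distrib[of "\<lambda>r. r * _"] cong: if_cong)
      finally show ?thesis .
    qed
    show "c j \<le> (\<Sum>i\<in>I. A i j * y i)" if "j \<in> J" for j
      using y that by (auto simp: G_def)
    show "(\<Sum>i\<in>I. b i * y i) \<le> (\<Sum>j\<in>J. c j * x j)"
      using y by (auto simp: G_def v_def sum_negf)
  qed
qed

section \<open>Complementary slackness\<close>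

text \<open>\<open>market_clearing\<close> is the slackness condition of the edges. Trips are tested
  by \<open>x r b > 0\<close>, not \<open>x r b = 1\<close>, so that the notion also fits fractional
  solutions.\<close>

definition complementary_slackness ::
    "('v, 'e, 'm) market \<Rightarrow> ('e, 'm) trip_vector \<Rightarrow> ('m \<Rightarrow> real) \<Rightarrow> ('e \<Rightarrow> real) \<Rightarrow> bool" where
  "complementary_slackness K x u \<tau> \<longleftrightarrow>
     (\<forall>m\<in>riders K. rider_load K x m < 1 \<longrightarrow> u m = 0) \<and> market_clearing K x \<tau> \<and>
     (\<forall>b\<in>groups K. \<forall>r\<in>routes K. x r b > 0 \<longrightarrow>
        (\<Sum>m\<in>b. u m) + (\<Sum>e\<in>set r. \<tau> e) = trip_value K r b)"

lemma sum_mult_of_bool_mem: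
  fixes f :: "'a \<Rightarrow> real"
  assumes "finite A" "B \<subseteq> A"
  shows "(\<Sum>a\<in>A. f a * of_bool (a \<in> B)) = (\<Sum>a\<in>B. f a)"
  using assms by (simp add: of_bool_def if_distrib[of "\<lambda>r. _ * r"] sum.If_cases Int_absorb1 cong: if_cong)

text \<open>A weight equal to 1 exhausts the total, so all other weights vanish.\<close>

lemma sum_mult_eq_single:
  fixes f :: "'a \<Rightarrow> real"
  assumes "finite S" "\<And>t. t \<in> S \<Longrightarrow> f t \<ge> 0" "(\<Sum>t\<in>S. f t) \<le> 1" "s \<in> S" "f s = 1"
  shows "(\<Sum>t\<in>S. f t * g t) = g s"
proof -
  have "(\<Sum>t\<in>S - {s}. f t) \<le> 0"
    using assms by (simp add: sum.remove[of S s])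
  moreover have "(\<Sum>t\<in>S - {s}. f t) \<ge> 0"
    using assms by (intro sum_nonneg) auto
  ultimately have "\<forall>t\<in>S - {s}. f t = 0"
    using assms by (subst sum_nonneg_eq_0_iff[symmetric]) auto
  then show ?thesis
    using assms by (simp add: sum.remove[of S s])
qed

section \<open>Loads, duality gap and strong duality for the market\<close>

context carpooling_market
begin

lemma finite_routes: "finite (routes K)"
  unfolding routes_def by (rule apaths_finite)

lemma finite_groups: "finite (groups K)"
  using finite_riders unfolding groups_def by (auto intro: finite_subset[of _ "Pow (riders K)"])

lemma route_edges: "r \<in> routes K \<Longrightarrow> set r \<subseteq> edges K"
  by (auto simp: routes_def apath_def)

lemma group_riders: "b \<in> groups K \<Longrightarrow> b \<subseteq> riders K"
  by (simp add: groups_def)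

text \<open>Indicator weights replace the restricted index set, so that sums can be swapped and
  loads become rows of a constraint matrix.\<close>

lemma rider_load_alt:
  "rider_load K x m = (\<Sum>r\<in>routes K. \<Sum>b\<in>groups K. of_bool (m \<in> b) * x r b)"
  unfolding rider_load_def
  by (simp add: sum.inter_filter finite_groups of_bool_def if_distrib[of "\<lambda>r. r * _"] cong: if_cong)

lemma edge_load_alt:
  "edge_load K x e = (\<Sum>r\<in>routes K. \<Sum>b\<in>groups K. of_bool (e \<in> set r) * x r b)"
  unfolding edge_load_def
  by (subst sum.inter_filter) (auto simp: finite_routes intro!: sum.cong)

text \<open>Double counting of the pairs of a rider and a trip containing that rider.\<close>

lemma sum_rider_load:
  "(\<Sum>m\<in>riders K. u m * rider_load K x m) =
     (\<Sum>b\<in>groups K. \<Sum>r\<in>routes K. x r b * (\<Sum>m\<in>b. u m))"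
proof -
  have "(\<Sum>m\<in>riders K. u m * rider_load K x m) =
      (\<Sum>m\<in>riders K. \<Sum>b\<in>groups K. \<Sum>r\<in>routes K. u m * of_bool (m \<in> b) * x r b)"
    unfolding rider_load_alt
    by (subst sum.swap) (simp add: sum_distrib_left mult.assoc)
  also have "\<dots> = (\<Sum>b\<in>groups K. \<Sum>r\<in>routes K. \<Sum>m\<in>riders K. u m * of_bool (m \<in> b) * x r b)"
    by (subst sum.swap, intro sum.cong refl) (rule sum.swap)
  also have "\<dots> = (\<Sum>b\<in>groups K. \<Sum>r\<in>routes K. x r b * (\<Sum>m\<in>b. u m))"
    by (intro sum.cong refl)
      (simp only: sum_distrib_right[symmetric] mult.commute[of "x _ _"]
        sum_mult_of_bool_mem[OF finite_riders group_riders])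
  finally show ?thesis .
qed

lemma sum_edge_load:
  "(\<Sum>e\<in>edges K. \<tau> e * edge_load K x e) =
     (\<Sum>b\<in>groups K. \<Sum>r\<in>routes K. x r b * (\<Sum>e\<in>set r. \<tau> e))"
proof -
  have "(\<Sum>e\<in>edges K. \<tau> e * edge_load K x e) =
      (\<Sum>e\<in>edges K. \<Sum>b\<in>groups K. \<Sum>r\<in>routes K. \<tau> e * of_bool (e \<in> set r) * x r b)"
    unfolding edge_load_alt
    by (subst sum.swap) (simp add: sum_distrib_left mult.assoc)
  also have "\<dots> = (\<Sum>b\<in>groups K. \<Sum>r\<in>routes K. \<Sum>e\<in>edges K. \<tau> e * of_bool (e \<in> set r) * x r b)"
    by (subst sum.swap, intro sum.cong refl) (rule sum.swap)
  also have "\<dots> = (\<Sum>b\<in>groups K. \<Sum>r\<in>routes K. x r b * (\<Sum>e\<in>set r. \<tau> e))"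
    by (intro sum.cong refl)
      (simp only: sum_distrib_right[symmetric] mult.commute[of "x _ _"]
        sum_mult_of_bool_mem[OF finite_arcs route_edges])
  finally show ?thesis .
qed

text \<open>An algebraic identity: the terms pairing dual variables with loads cancel by
  \<open>sum_rider_load\<close> and \<open>sum_edge_load\<close>. What remains is one product of a
  variable and a slack per rider, edge and trip.\<close>

lemma duality_gap:
  "dual_objective K (u, \<tau>) - lp_objective K x =
     (\<Sum>m\<in>riders K. u m * (1 - rider_load K x m)) +
     (\<Sum>e\<in>edges K. \<tau> e * (real (capacity K e) - edge_load K x e)) +
     (\<Sum>b\<in>groups K. \<Sum>r\<in>routes K.
        x r b * ((\<Sum>m\<in>b. u m) + (\<Sum>e\<in>set r. \<tau> e) - trip_value K r b))"
  using sum_rider_load[of u x] sum_edge_load[of \<tau> x]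
  by (simp add: dual_objective_def lp_objective_def right_diff_distrib distrib_left sum.distrib
      sum_subtractf mult.commute)

text \<open>Feasibility makes every product in \<open>duality_gap\<close> nonnegative. So the gap is
  nonnegative, and it is zero only if each product is.\<close>

lemma
  assumes "lp_feasible K x" "dual_feasible K (u, \<tau>)"
  shows weak_duality: "lp_objective K x \<le> dual_objective K (u, \<tau>)"
    and objectives_eq_iff:
      "dual_objective K (u, \<tau>) = lp_objective K x \<longleftrightarrow> complementary_slackness K x u \<tau>"
proof -
  let ?trip_slack = "\<lambda>b r. (\<Sum>m\<in>b. u m) + (\<Sum>e\<in>set r. \<tau> e) - trip_value K r b"
  let ?P = "\<Sum>m\<in>riders K. u m * (1 - rider_load K x m)"
  let ?Q = "\<Sum>e\<in>edges K. \<tau> e * (real (capacity K e) - edge_load K x e)"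
  let ?R = "\<Sum>b\<in>groups K. \<Sum>r\<in>routes K. x r b * ?trip_slack b r"
  have P: "u m * (1 - rider_load K x m) \<ge> 0" if "m \<in> riders K" for m
    using assms that by (simp add: lp_feasible_def dual_feasible_def)
  have Q: "\<tau> e * (real (capacity K e) - edge_load K x e) \<ge> 0" if "e \<in> edges K" for e
    using assms that by (simp add: lp_feasible_def dual_feasible_def)
  have R: "x r b * ?trip_slack b r \<ge> 0" if "b \<in> groups K" "r \<in> routes K" for b r
    using assms that by (simp add: lp_feasible_def dual_feasible_def)
  have nonneg: "?P \<ge> 0" "?Q \<ge> 0" "?R \<ge> 0"
    by (auto intro!: sum_nonneg P Q R)
  then show "lp_objective K x \<le> dual_objective K (u, \<tau>)"
    using duality_gap[of u \<tau> x] by linarith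
  have "?P = 0 \<longleftrightarrow> (\<forall>m\<in>riders K. rider_load K x m < 1 \<longrightarrow> u m = 0)"
    using assms(1) by (subst sum_nonneg_eq_0_iff)
      (auto simp: finite_riders P lp_feasible_def less_le)
  moreover have "?Q = 0 \<longleftrightarrow> market_clearing K x \<tau>"
    using assms(1) by (subst sum_nonneg_eq_0_iff)
      (auto simp: Q lp_feasible_def market_clearing_def less_le)
  moreover have "?R = 0 \<longleftrightarrow> (\<forall>b\<in>groups K. \<forall>r\<in>routes K. x r b > 0 \<longrightarrow>
      (\<Sum>m\<in>b. u m) + (\<Sum>e\<in>set r. \<tau> e) = trip_value K r b)"
  proof -
    have "?R = 0 \<longleftrightarrow> (\<forall>b\<in>groups K. \<forall>r\<in>routes K. x r b * ?trip_slack b r = 0)"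
      by (simp add: sum_nonneg_eq_0_iff finite_groups finite_routes R sum_nonneg)
    then show ?thesis
      using assms(1) by (fastforce simp: lp_feasible_def less_le)
  qed
  ultimately show "dual_objective K (u, \<tau>) = lp_objective K x \<longleftrightarrow> complementary_slackness K x u \<tau>"
    unfolding complementary_slackness_def using nonneg duality_gap[of u \<tau> x] by linarith
qed

text \<open>\<open>lp_strong_duality\<close> bounds the dual value from above by the primal one;
  \<open>weak_duality\<close> gives the other direction.\<close>

lemma strong_duality:
  assumes "lp_optimal K x"
  obtains u \<tau> where "dual_feasible K (u, \<tau>)" "dual_objective K (u, \<tau>) = lp_objective K x"
proof -
  \<comment> \<open>Rows are riders and edges, columns are trips; the matrix \<open>?A\<close>
    records membership of a rider in the group or of an edge in the route.\<close>
  let ?I = "riders K <+> edges K" and ?J = "routes K \<times> groups K"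
  let ?A = "\<lambda>i j. case i of Inl m \<Rightarrow> of_bool (m \<in> snd j) | Inr e \<Rightarrow> (of_bool (e \<in> set (fst j)) :: real)"
  let ?b = "\<lambda>i. case i of Inl m \<Rightarrow> 1 | Inr e \<Rightarrow> real (capacity K e)"
  let ?c = "\<lambda>(r, b). trip_value K r b"
  have rows: "(\<Sum>j\<in>?J. of_bool (m \<in> snd j) * z j) = rider_load K (curry z) m"
    "(\<Sum>j\<in>?J. of_bool (e \<in> set (fst j)) * z j) = edge_load K (curry z) e" for m e z
    by (simp_all add: rider_load_alt edge_load_alt sum.cartesian_product case_prod_beta)
  have obj: "(\<Sum>j\<in>?J. ?c j * z j) = lp_objective K (curry z)" for z
    unfolding lp_objective_def
    by (subst sum.swap) (simp add: sum.cartesian_product case_prod_beta)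
  have feas: "lp_feasible K (curry z) \<longleftrightarrow>
      (\<forall>j\<in>?J. z j \<ge> 0) \<and> (\<forall>i\<in>?I. (\<Sum>j\<in>?J. ?A i j * z j) \<le> ?b i)" for z
    by (auto simp: lp_feasible_def rows Plus_def ball_Un)
  have x: "lp_feasible K x" "\<And>y. lp_feasible K y \<Longrightarrow> lp_objective K y \<le> lp_objective K x"
    using assms by (auto simp: lp_optimal_def is_arg_max_linorder)
  let ?x = "case_prod x"
  have fin: "finite ?I" "finite ?J"
    using finite_riders finite_routes finite_groups by auto
  have x_feas: "lp_feasible K (curry ?x)" using x(1) by simp
  have "\<exists>y. (\<forall>i\<in>?I. y i \<ge> 0) \<and> (\<forall>j\<in>?J. ?c j \<le> (\<Sum>i\<in>?I. ?A i j * y i)) \<and>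
    (\<Sum>i\<in>?I. ?b i * y i) \<le> (\<Sum>j\<in>?J. ?c j * ?x j)"
  proof (rule lp_strong_duality[OF fin, of ?x ?A ?b ?c])
    show "?x j \<ge> 0" if "j \<in> ?J" for j
      using x_feas that unfolding feas by blast
    show "(\<Sum>j\<in>?J. ?A i j * ?x j) \<le> ?b i" if "i \<in> ?I" for i
      using x_feas that unfolding feas by blast
    show "(\<Sum>j\<in>?J. ?c j * z j) \<le> (\<Sum>j\<in>?J. ?c j * ?x j)"
      if "\<And>j. j \<in> ?J \<Longrightarrow> z j \<ge> 0" "\<And>i. i \<in> ?I \<Longrightarrow> (\<Sum>j\<in>?J. ?A i j * z j) \<le> ?b i" for z
    proof -
      have "lp_feasible K (curry z)" using that unfolding feas by blast
      then show ?thesis using x(2) by (simp add: obj)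
    qed
  qed
  then obtain y where y: "\<forall>i\<in>?I. y i \<ge> 0"
    "\<forall>j\<in>?J. ?c j \<le> (\<Sum>i\<in>?I. ?A i j * y i)"
    "(\<Sum>i\<in>?I. ?b i * y i) \<le> (\<Sum>j\<in>?J. ?c j * ?x j)"
    by blast
  define u where "u m = y (Inl m)" for m
  define \<tau> where "\<tau> e = y (Inr e)" for e
  have "trip_value K r b \<le> (\<Sum>m\<in>b. u m) + (\<Sum>e\<in>set r. \<tau> e)"
    if "b \<in> groups K" "r \<in> routes K" for b r
  proof -
    have "trip_value K r b \<le> (\<Sum>m\<in>riders K. of_bool (m \<in> b) * u m) +
        (\<Sum>e\<in>edges K. of_bool (e \<in> set r) * \<tau> e)"
      using bspec[OF y(2), of "(r, b)"] that by (simp add: sum.Plus finite_riders u_def \<tau>_def)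
    then show ?thesis
      using Int_absorb1[OF group_riders] Int_absorb1[OF route_edges] that
      by (simp add: finite_riders)
  qed
  then have dual: "dual_feasible K (u, \<tau>)"
    using y(1) by (auto simp: dual_feasible_def u_def \<tau>_def)
  have "dual_objective K (u, \<tau>) \<le> lp_objective K x"
    using y(3) unfolding obj by (simp add: dual_objective_def sum.Plus finite_riders u_def \<tau>_def)
  with weak_duality[OF x(1) dual] dual that show ?thesis by fastforce
qed

section \<open>Integer trip vectors\<close>

lemma trip_le_rider_load:
  assumes "lp_feasible K x" "b \<in> groups K" "r \<in> routes K" "m \<in> b"
  shows "x r b \<le> rider_load K x m"
proof -
  have "x r b \<le> (\<Sum>b\<in>{b \<in> groups K. m \<in> b}. x r b)"
    using assms finite_groups by (intro member_le_sum) (auto simp: lp_feasible_def)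
  also have "\<dots> \<le> rider_load K x m"
    unfolding rider_load_def using assms finite_routes
    by (intro member_le_sum[of r _ "\<lambda>r. \<Sum>b\<in>{b \<in> groups K. m \<in> b}. x r b"])
      (auto simp: lp_feasible_def intro!: sum_nonneg)
  finally show ?thesis .
qed

text \<open>Groups are nonempty, and the unit load bound of any member caps the trip at 1.\<close>

lemma integer_feasible_binary:
  assumes "lp_feasible K x" "integer_valued K x" "b \<in> groups K" "r \<in> routes K"
  shows "x r b \<in> {0, 1}"
proof -
  obtain m where m: "m \<in> b" "m \<in> riders K"
    using assms(3) by (auto simp: groups_def)
  have "x r b \<le> 1"
    using trip_le_rider_load[OF assms(1,3,4) m(1)] assms(1) m(2)
    by (fastforce simp: lp_feasible_def)
  moreover have "0 \<le> x r b" "x r b \<in> \<int>"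
    using assms by (auto simp: lp_feasible_def integer_valued_def)
  ultimately show ?thesis by (auto elim!: Ints_cases)
qed

lemma outcome_iff:
  "outcome K x p \<tau> \<longleftrightarrow> lp_feasible K x \<and> integer_valued K x \<and> (\<forall>e\<in>edges K. \<tau> e \<ge> 0)"
proof
  assume "outcome K x p \<tau>"
  then show "lp_feasible K x \<and> integer_valued K x \<and> (\<forall>e\<in>edges K. \<tau> e \<ge> 0)"
    by (fastforce simp: outcome_def lp_feasible_def integer_valued_def)
next
  assume "lp_feasible K x \<and> integer_valued K x \<and> (\<forall>e\<in>edges K. \<tau> e \<ge> 0)"
  then show "outcome K x p \<tau>"
    using integer_feasible_binary[of x] by (simp add: outcome_def lp_feasible_def)
qed

text \<open>The load bound of \<open>m\<close> leaves no room for a second trip, so the sum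
  collapses to this one.\<close>

lemma gross_value_served:
  assumes "lp_feasible K x" "b \<in> groups K" "r \<in> routes K" "m \<in> b" "x r b = 1"
  shows "gross_value K x m = rider_value K m r b"
proof -
  let ?S = "routes K \<times> {b \<in> groups K. m \<in> b}"
  have "m \<in> riders K" using assms group_riders by auto
  then have "(\<Sum>t\<in>?S. case_prod x t) \<le> 1"
    using assms(1) by (simp add: lp_feasible_def rider_load_def sum.cartesian_product)
  then have "(\<Sum>t\<in>?S. case_prod x t * (\<lambda>(r, b). rider_value K m r b) t) =
      (\<lambda>(r, b). rider_value K m r b) (r, b)"
    using assms finite_routes finite_groups
    by (intro sum_mult_eq_single) (auto simp: lp_feasible_def)
  then show ?thesis
    by (simp add: gross_value_def sum.cartesian_product case_prod_beta)
qed

text \<open>Connects the wording of \<open>budget_balanced\<close> with the slackness of the rider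
  constraint: by integrality, a single nonzero trip of \<open>m\<close> already brings the load to
  1.\<close>

lemma unserved_iff:
  assumes "lp_feasible K x" "integer_valued K x"
  shows "(\<forall>r\<in>routes K. \<forall>b\<in>groups K. m \<in> b \<longrightarrow> x r b = 0) \<longleftrightarrow> rider_load K x m < 1"
proof
  assume "\<forall>r\<in>routes K. \<forall>b\<in>groups K. m \<in> b \<longrightarrow> x r b = 0"
  then have "rider_load K x m = 0" by (simp add: rider_load_def)
  then show "rider_load K x m < 1" by simp
next
  assume "rider_load K x m < 1"
  then show "\<forall>r\<in>routes K. \<forall>b\<in>groups K. m \<in> b \<longrightarrow> x r b = 0"
    using trip_le_rider_load[OF assms(1)] integer_feasible_binary[OF assms] by fastforce
qed

text \<open>
  For the riders of a realised trip, payments are values minus utilities, so covering tolls and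
  cost is the same as splitting the trip value net of tolls.
\<close>

lemma budget_balanced_iff:
  assumes "lp_feasible K x" "integer_valued K x"
  shows "budget_balanced K x p \<tau> \<longleftrightarrow>
    (\<forall>b\<in>groups K. \<forall>r\<in>routes K. x r b > 0 \<longrightarrow>
       (\<Sum>m\<in>b. utility K x p m) + (\<Sum>e\<in>set r. \<tau> e) = trip_value K r b) \<and>
    (\<forall>m\<in>riders K. rider_load K x m < 1 \<longrightarrow> utility K x p m = 0)"
proof -
  have "x r b = 1 \<longleftrightarrow> x r b > 0" if "b \<in> groups K" "r \<in> routes K" for b r
    using integer_feasible_binary[OF assms that] by auto
  moreover have "(\<Sum>m\<in>b. p m) = (\<Sum>e\<in>set r. \<tau> e) + trip_cost K r b \<longleftrightarrow>
      (\<Sum>m\<in>b. utility K x p m) + (\<Sum>e\<in>set r. \<tau> e) = trip_value K r b"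
    if "b \<in> groups K" "r \<in> routes K" "x r b = 1" for b r
  proof -
    have "(\<Sum>m\<in>b. utility K x p m) = (\<Sum>m\<in>b. rider_value K m r b) - (\<Sum>m\<in>b. p m)"
      using gross_value_served[OF assms(1) that(1,2) _ that(3)]
      by (simp add: utility_def sum_subtractf)
    then show ?thesis by (auto simp: trip_value_def)
  qed
  moreover have "p m = 0 \<longleftrightarrow> utility K x p m = 0" if "rider_load K x m < 1" for m
  proof -
    have "gross_value K x m = 0"
      using that unfolding unserved_iff[OF assms, symmetric] by (simp add: gross_value_def)
    then show ?thesis by (simp add: utility_def)
  qed
  ultimately show ?thesis
    unfolding budget_balanced_def unserved_iff[OF assms]
    by (intro arg_cong2[where f = "(\<and>)"] ball_cong refl) auto
qed

section \<open>Equilibria as pairs of primal and dual optima\<close>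

text \<open>Individual rationality, stability and nonnegative tolls amount to dual feasibility;
  budget balance and market clearing amount to complementary slackness, which
  \<open>objectives_eq_iff\<close> turns into equal objective values.\<close>

lemma market_equilibrium_iff:
  "market_equilibrium K x p \<tau> \<longleftrightarrow> lp_feasible K x \<and> integer_valued K x \<and>
     dual_feasible K (utility K x p, \<tau>) \<and>
     dual_objective K (utility K x p, \<tau>) = lp_objective K x"
proof (cases "lp_feasible K x \<and> integer_valued K x")
  case True
  have "market_equilibrium K x p \<tau> \<longleftrightarrow> dual_feasible K (utility K x p, \<tau>) \<and>
      complementary_slackness K x (utility K x p) \<tau>"
    using True by (auto simp: market_equilibrium_def outcome_iff individually_rational_def
        stable_def budget_balanced_iff dual_feasible_def complementary_slackness_def
        diff_le_eq)
  then show ?thesis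
    using True objectives_eq_iff by blast
next
  case False
  then show ?thesis by (auto simp: market_equilibrium_def outcome_iff)
qed

text \<open>Utility vectors are total functions, while a dual solution and the induced utilities are
  compared on \<open>riders K\<close> only.\<close>

lemma dual_cong:
  assumes "\<And>m. m \<in> riders K \<Longrightarrow> u m = u' m"
  shows "dual_feasible K (u, \<tau>) \<longleftrightarrow> dual_feasible K (u', \<tau>)"
    and "dual_objective K (u, \<tau>) = dual_objective K (u', \<tau>)"
proof -
  have "(\<Sum>m\<in>b. u m) = (\<Sum>m\<in>b. u' m)" if "b \<in> groups K" for b
    using assms group_riders[OF that] by (intro sum.cong) auto
  then show "dual_feasible K (u, \<tau>) \<longleftrightarrow> dual_feasible K (u', \<tau>)"
    using assms by (simp add: dual_feasible_def)
  show "dual_objective K (u, \<tau>) = dual_objective K (u', \<tau>)"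
    using assms by (simp add: dual_objective_def)
qed

text \<open>The utilities and tolls of the equilibrium certify optimality through weak
  duality.\<close>

lemma equilibrium_lp_optimal:
  assumes "market_equilibrium K x p \<tau>"
  shows "lp_optimal K x"
  using assms weak_duality[of _ "utility K x p" \<tau>]
  by (auto simp: market_equilibrium_iff lp_optimal_def is_arg_max_linorder)

text \<open>By strong duality the lower bound from weak duality is attained, so it is the dual
  minimum.\<close>

lemma dual_optimal_iff:
  assumes "lp_optimal K x"
  shows "dual_optimal K u \<tau> \<longleftrightarrow>
    dual_feasible K (u, \<tau>) \<and> dual_objective K (u, \<tau>) = lp_objective K x"
proof -
  obtain u' \<tau>' where opt: "dual_feasible K (u', \<tau>')"
    "dual_objective K (u', \<tau>') = lp_objective K x"
    using strong_duality[OF assms] .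
  have "lp_objective K x \<le> dual_objective K (v, \<sigma>)" if "dual_feasible K (v, \<sigma>)" for v \<sigma>
    using assms that by (intro weak_duality) (auto simp: lp_optimal_def is_arg_max_linorder)
  with opt show ?thesis
    unfolding dual_optimal_def is_arg_min_linorder by (metis antisym surj_pair)
qed

text \<open>Primal and dual optima can be paired arbitrarily, since equality of objective values
  does not depend on which optima are chosen.\<close>

lemma optimal_equilibrium:
  assumes "lp_optimal K x" "integer_valued K x" "dual_optimal K u \<tau>"
    and "\<And>m. m \<in> riders K \<Longrightarrow> utility K x p m = u m"
  shows "market_equilibrium K x p \<tau>"
  using assms(1-3) dual_cong[OF assms(4)]
  by (auto simp: market_equilibrium_iff dual_optimal_iff lp_optimal_def is_arg_max_linorder)

end

theorem theorem1:
  fixes K :: "('v, 'e, 'm) market"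
  assumes "carpooling_market K"
  shows "((\<exists>x p \<tau>. market_equilibrium K x p \<tau>) \<longleftrightarrow>
            (\<exists>x. lp_optimal K x \<and> integer_valued K x)) \<and>
         ((\<exists>x. lp_optimal K x \<and> integer_valued K x) \<longrightarrow>
            (\<forall>x. lp_optimal K x \<and> integer_valued K x \<longrightarrow>
               (\<exists>p \<tau>. market_equilibrium K x p \<tau>)) \<and>
            (\<forall>u \<tau>. dual_optimal K u \<tau> \<longrightarrow>
               (\<exists>x p. market_equilibrium K x p \<tau> \<and> (\<forall>m\<in>riders K. utility K x p m = u m))) \<and>
            (\<forall>x u \<tau>. lp_optimal K x \<and> integer_valued K x \<and> dual_optimal K u \<tau> \<longrightarrow>
               (\<forall>p. (market_equilibrium K x p \<tau> \<and> (\<forall>m\<in>riders K. utility K x p m = u m)) \<longleftrightarrow>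
                    (\<forall>m\<in>riders K.
                       p m = (\<Sum>r\<in>routes K. \<Sum>b\<in>{b \<in> groups K. m \<in> b}.
                                x r b * rider_value K m r b) - u m))))"
proof -
  interpret carpooling_market K by fact
  have payment: "utility K x p m = u m \<longleftrightarrow>
      p m = (\<Sum>r\<in>routes K. \<Sum>b\<in>{b \<in> groups K. m \<in> b}. x r b * rider_value K m r b) - u m"
    for x p u m
    by (auto simp: utility_def gross_value_def)
  \<comment> \<open>These payments are chosen so that the induced utilities are exactly
    \<open>u\<close>.\<close>
  have eq: "market_equilibrium K x (\<lambda>m. gross_value K x m - u m) \<tau>"
    if "lp_optimal K x" "integer_valued K x" "dual_optimal K u \<tau>" for x u \<tau>
    using that by (rule optimal_equilibrium) (simp add: utility_def)
  \<comment> \<open>Strong duality supplies a dual optimum to pair with \<open>x\<close>.\<close>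
  have ex: "\<exists>p \<tau>. market_equilibrium K x p \<tau>" if "lp_optimal K x" "integer_valued K x" for x
    using eq[OF that] strong_duality[OF that(1)] dual_optimal_iff[OF that(1)] by metis
  have opt: "lp_optimal K x \<and> integer_valued K x" if "market_equilibrium K x p \<tau>" for x p \<tau>
    using that equilibrium_lp_optimal market_equilibrium_iff by blast
  have util: "\<exists>p. market_equilibrium K x p \<tau> \<and> (\<forall>m\<in>riders K. utility K x p m = u m)"
    if "lp_optimal K x" "integer_valued K x" "dual_optimal K u \<tau>" for x u \<tau>
    using eq[OF that] by (intro exI[of _ "\<lambda>m. gross_value K x m - u m"]) (simp add: utility_def)
  show ?thesis
  proof (intro conjI impI allI)
    show "(\<exists>x p \<tau>. market_equilibrium K x p \<tau>) \<longleftrightarrow> (\<exists>x. lp_optimal K x \<and> integer_valued K x)"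
      using ex opt by blast
  next
    fix x assume "lp_optimal K x \<and> integer_valued K x"
    then show "\<exists>p \<tau>. market_equilibrium K x p \<tau>" using ex by blast
  next
    fix u \<tau> assume "\<exists>x. lp_optimal K x \<and> integer_valued K x" "dual_optimal K u \<tau>"
    then show "\<exists>x p. market_equilibrium K x p \<tau> \<and> (\<forall>m\<in>riders K. utility K x p m = u m)"
      using util by blast
  next
    fix x u \<tau> p
    assume "lp_optimal K x \<and> integer_valued K x \<and> dual_optimal K u \<tau>"
    then show "market_equilibrium K x p \<tau> \<and> (\<forall>m\<in>riders K. utility K x p m = u m) \<longleftrightarrow>
        (\<forall>m\<in>riders K. p m =
          (\<Sum>r\<in>routes K. \<Sum>b\<in>{b \<in> groups K. m \<in> b}. x r b * rider_value K m r b) - u m)"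
      \<comment> \<open>Once the payment formula is read as \<open>utility K x p m = u m\<close>,
        only the equilibrium property remains, and \<open>optimal_equilibrium\<close> yields
        it.\<close>
      unfolding payment[symmetric] using optimal_equilibrium by blast
  qed
qed

end
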